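(* Let $a,b$ be positive integers with $b\ge a$, and define $$f(\alpha,(d_t,d_a,d_b))=(a+b)^\alpha d_t+a d_a+b d_b-a^\alpha-b^\alpha .$$ Then for all $d_t,d_a,d_b\in\mathbb{R}_{\ge 0}$ and all $\alpha\in[0,1)$, $$f(\alpha,(d_t,d_a,d_b))\ \ge\ \min\Big(f(0,(d_t,d_a,d_b)),\ f\Big(1,\Big(\tfrac{\log(a)\,a+\log(b)\,b}{\log(a+b)(a+b)},d_a,d_b\Big)\Big),\ f(1,(d_t,d_a,d_b))\Big).$$ *)

theory Defs
  imports Complex_Main
begin

definition f :: "nat \<Rightarrow> nat \<Rightarrow> real \<Rightarrow> real \<times> real \<times> real \<Rightarrow> real" where
  "f a b \<alpha> = (\<lambda>(d\<^sub>t, d\<^sub>a, d\<^sub>b).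
     (real a + real b) powr \<alpha> * d\<^sub>t + real a * d\<^sub>a + real b * d\<^sub>b
       - real a powr \<alpha> - real b powr \<alpha>)"

end

theory Submission
  imports Defs
begin

text \<open>
  Up to a constant, \<open>\<alpha> \<mapsto> f \<alpha> d\<close> is \<open>s\<^sup>\<alpha> d\<^sub>t - a\<^sup>\<alpha> - b\<^sup>\<alpha>\<close> with \<open>s = a + b\<close>. If its minimum over
  \<open>[0, 1]\<close> is attained at an interior point \<open>\<beta>\<close>, then \<open>\<beta>\<close> is critical, which determines \<open>d\<^sub>t\<close> and
  turns the minimum into \<open>- a\<^sup>\<beta> (1 - log\<^sub>s a) - b\<^sup>\<beta> (1 - log\<^sub>s b)\<close>. This is decreasing in \<open>\<beta>\<close>, and
  its value at \<open>\<beta> = 1\<close> is the middle term of the claimed bound.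
\<close>

lemma endpoint_or_critical_point_le:
  fixes g g' :: "real \<Rightarrow> real"
  assumes cont: "continuous_on {u..v} g"
    and deriv: "\<And>y. \<lbrakk>u < y; y < v\<rbrakk> \<Longrightarrow> (g has_real_derivative g' y) (at y)"
    and x: "x \<in> {u..v}"
  obtains (left) "g u \<le> g x" | (right) "g v \<le> g x"
    | (critical) c where "u < c" "c < v" "g' c = 0" "g c \<le> g x"
proof -
  obtain c where c: "c \<in> {u..v}" and c_min: "\<And>y. y \<in> {u..v} \<Longrightarrow> g c \<le> g y"
    using continuous_attains_inf[OF compact_Icc _ cont] x by auto
  consider "c = u" | "c = v" | (interior) "u < c" "c < v"
    using c by fastforce
  then show thesis
  proof cases
    case interior
    have "g' c = 0"
    proof (rule DERIV_local_min[OF deriv[OF interior]])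
      show "0 < min (c - u) (v - c)"
        using interior by simp
      show "\<forall>y. \<bar>c - y\<bar> < min (c - u) (v - c) \<longrightarrow> g c \<le> g y"
        by (auto intro!: c_min)
    qed
    then show thesis
      using critical interior c_min[OF x] by blast
  qed (use left right c_min[OF x] in auto)
qed

definition power_gap :: "real \<Rightarrow> ('i \<Rightarrow> real) \<Rightarrow> 'i set \<Rightarrow> real \<Rightarrow> real \<Rightarrow> real" where
  "power_gap s x I d \<alpha> = s powr \<alpha> * d - (\<Sum>i\<in>I. x i powr \<alpha>)"

definition critical_coeff :: "real \<Rightarrow> ('i \<Rightarrow> real) \<Rightarrow> 'i set \<Rightarrow> real \<Rightarrow> real" where
  "critical_coeff s x I \<alpha> = (\<Sum>i\<in>I. ln (x i) * x i powr \<alpha>) / (ln s * s powr \<alpha>)"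

lemma power_gap_has_real_derivative:
  assumes "s > 0" and "\<And>i. i \<in> I \<Longrightarrow> x i > 0"
  shows "(power_gap s x I d has_real_derivative
    ln s * s powr \<alpha> * d - (\<Sum>i\<in>I. ln (x i) * x i powr \<alpha>)) (at \<alpha>)"
  unfolding power_gap_def[abs_def]
  using assms by (auto intro!: derivative_eq_intros sum.cong)

lemma power_gap_critical_coeff:
  assumes "s > 1"
  shows "power_gap s x I (critical_coeff s x I \<alpha>) \<alpha> = - (\<Sum>i\<in>I. x i powr \<alpha> * (1 - log s (x i)))"
proof -
  have "s powr \<alpha> * critical_coeff s x I \<alpha> = (\<Sum>i\<in>I. ln (x i) * x i powr \<alpha>) / ln s"
    using assms by (simp add: critical_coeff_def)
  also have "\<dots> = (\<Sum>i\<in>I. x i powr \<alpha> * log s (x i))"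
    by (simp add: log_def sum_divide_distrib mult.commute)
  finally show ?thesis
    by (simp add: power_gap_def right_diff_distrib sum_subtractf)
qed

lemma power_gap_critical_coeff_antimono:
  assumes "s > 1" and x: "\<And>i. i \<in> I \<Longrightarrow> 1 \<le> x i \<and> x i \<le> s" and "\<beta> \<le> \<gamma>"
  shows "power_gap s x I (critical_coeff s x I \<gamma>) \<gamma> \<le> power_gap s x I (critical_coeff s x I \<beta>) \<beta>"
proof -
  have "x i powr \<beta> * (1 - log s (x i)) \<le> x i powr \<gamma> * (1 - log s (x i))" if "i \<in> I" for i
  proof (rule mult_right_mono)
    show "x i powr \<beta> \<le> x i powr \<gamma>"
      using x[OF that] \<open>\<beta> \<le> \<gamma>\<close> by (simp add: powr_mono)
    show "0 \<le> 1 - log s (x i)"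
      using x[OF that] \<open>s > 1\<close> by simp
  qed
  then show ?thesis
    unfolding power_gap_critical_coeff[OF \<open>s > 1\<close>] neg_le_iff_le by (rule sum_mono)
qed

lemma power_gap_ge_Min:
  assumes "s > 1" and x: "\<And>i. i \<in> I \<Longrightarrow> 1 \<le> x i \<and> x i \<le> s" and \<alpha>: "\<alpha> \<in> {u..v}"
  shows "power_gap s x I d \<alpha> \<ge>
    Min {power_gap s x I d u,
         power_gap s x I (critical_coeff s x I v) v,
         power_gap s x I d v}"
proof -
  let ?g' = "\<lambda>\<beta>. ln s * s powr \<beta> * d - (\<Sum>i\<in>I. ln (x i) * x i powr \<beta>)"
  have deriv: "(power_gap s x I d has_real_derivative ?g' \<beta>) (at \<beta>)" for \<beta>
    using \<open>s > 1\<close> x by (intro power_gap_has_real_derivative) force+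
  then have "continuous_on {u..v} (power_gap s x I d)"
    by (intro continuous_at_imp_continuous_on ballI DERIV_isCont)
  then show ?thesis
    using deriv \<alpha>
  proof (cases rule: endpoint_or_critical_point_le)
    case (critical \<beta>)
    have "d = critical_coeff s x I \<beta>"
      using \<open>?g' \<beta> = 0\<close> \<open>s > 1\<close> by (simp add: critical_coeff_def field_simps)
    then have "power_gap s x I (critical_coeff s x I v) v \<le> power_gap s x I d \<beta>"
      using power_gap_critical_coeff_antimono[of s I x \<beta> v] \<open>s > 1\<close> x \<open>\<beta> < v\<close> by simp
    then show ?thesis
      using \<open>power_gap s x I d \<beta> \<le> power_gap s x I d \<alpha>\<close> by (simp add: min_le_iff_disj)
  qed (simp_all add: min_le_iff_disj)
qed

text \<open>Indexing by booleans rather than by \<open>{a, b}\<close> keeps both summands when \<open>a = b\<close>.\<close>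

lemma f_eq_power_gap:
  "f a b \<alpha> (d\<^sub>t, d\<^sub>a, d\<^sub>b) =
    power_gap (real a + real b) (case_bool (real a) (real b)) UNIV d\<^sub>t \<alpha> + (real a * d\<^sub>a + real b * d\<^sub>b)"
  by (simp add: f_def power_gap_def UNIV_bool)

theorem lemma11:
  fixes a b :: nat and d\<^sub>t d\<^sub>a d\<^sub>b \<alpha> :: real
  assumes "a > 0" and "b > 0" and "b \<ge> a"
    and "d\<^sub>t \<ge> 0" and "d\<^sub>a \<ge> 0" and "d\<^sub>b \<ge> 0"
    and "\<alpha> \<in> {0..<1}"
  shows "f a b \<alpha> (d\<^sub>t, d\<^sub>a, d\<^sub>b) \<ge>
    Min {f a b 0 (d\<^sub>t, d\<^sub>a, d\<^sub>b),
         f a b 1 ((ln (real a) * real a + ln (real b) * real b)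
                    / (ln (real a + real b) * (real a + real b)), d\<^sub>a, d\<^sub>b),
         f a b 1 (d\<^sub>t, d\<^sub>a, d\<^sub>b)}"
proof -
  let ?s = "real a + real b" and ?x = "case_bool (real a) (real b)"
  have critical: "(ln (real a) * real a + ln (real b) * real b) / (ln ?s * ?s)
      = critical_coeff ?s ?x UNIV 1"
    using assms by (simp add: critical_coeff_def UNIV_bool add.commute)
  have "power_gap ?s ?x UNIV d\<^sub>t \<alpha> \<ge>
      Min {power_gap ?s ?x UNIV d\<^sub>t 0,
           power_gap ?s ?x UNIV (critical_coeff ?s ?x UNIV 1) 1,
           power_gap ?s ?x UNIV d\<^sub>t 1}"
    using assms by (intro power_gap_ge_Min) (auto split: bool.split)
  then show ?thesis
    unfolding critical f_eq_power_gap by (simp add: min_le_iff_disj)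
qed

end
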